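(* Let $\Gamma$ be a free numerical semigroup with respect to the arrangement $(n_1,\ldots,n_e)$ of its minimal generators, and let $c_i=d_i/d_{i+1}$ with $d_i=\gcd(n_1,\dots,n_{i-1})$ for $i\in\{2,\dots,e\}$ and $d_{e+1}=\gcd(n_1,\dots,n_e)=1$. If $\frac{c_i-1}{c_i}\, n_i\ge n_1$ for all $i\in\{3,\ldots,e\}$, then $\mathrm E(\Gamma,2)=\mathrm m(\Gamma)$.
   Context: $\mathbb N$ denotes the non-negative integers. A numerical semigroup is a set $\langle n_1,\dots,n_m\rangle:=n_1\mathbb N+\cdots+n_m\mathbb N$ with $n_i$ positive integers and $\gcd(n_1,\dots,n_m)=1$. The minimal generators of $\Gamma$ are the elements of its unique minimal generating set. The multiplicity $\mathrm m(\Gamma)$ is the smallest positive element of $\Gamma$. For $x\in\mathbb Z$, the Apéry set is $\operatorname{Ap}(\Gamma,x)=\{a\in\Gamma\mid a-x\notin\Gamma\}$. Free: given an arrangement (ordering) $(n_1,\dots,n_e)$ of the minimal generators of $\Gamma$, put $d_i:=\gcd(n_1,\ldots,n_{i-1})$ and $c_i:=d_i/d_{i+1}$. The semigroup $\Gamma$ is free with respect to the arrangement $(n_1,\dots,n_e)$ (not necessarily increasing) if $d_i>d_{i+1}$ and $c_in_i\in\langle n_1,\ldots,n_{i-1}\rangle$ for all $i\in\{2,\ldots,e\}$. ($\mathbb N$ itself, with $e=1$, counts as free.) Second Feng-Rao number: for $b\in\Gamma$ let $\mathrm D(b)=\{c\in\Gamma\mid b-c\in\Gamma\}$, and let $\delta^2_{FR}(a)=\min\{\#(\mathrm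 D(b_1)\cup \mathrm D(b_2))\mid b_1,b_2\in\Gamma,\ a\le b_1<b_2\}$. With $c$ the conductor of $\Gamma$ (least integer $c\ge0$ such that all integers $\ge c$ lie in $\Gamma$) and $g=\#(\mathbb N\setminus\Gamma)$ the genus, $\mathrm E(\Gamma,2)$ is the constant such that $\delta^2_{FR}(a)=a+1-2g+\mathrm E(\Gamma,2)$ for all non-negative integers $a\ge 2c-1$. It is known (and may be taken as the definition) that $\mathrm E(\Gamma,2)=\min\{\#\operatorname{Ap}(\Gamma,x)\mid x\in\mathbb N\setminus\{0\}\}$. *)

theory Defs
  imports Complex_Main
begin

text \<open>The sum \<open>a\<^sub>1 \<nat> + \<dots> + a\<^sub>m \<nat>\<close>; only meaningful for finite \<open>A = {a\<^sub>1, \<dots>, a\<^sub>m}\<close>.\<close>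

definition generated :: "nat set \<Rightarrow> nat set" where
  "generated A = {\<Sum>a\<in>A. k a * a | k. True}"

definition numerical_semigroup :: "nat set \<Rightarrow> bool" where
  "numerical_semigroup \<Gamma> \<longleftrightarrow>
     (\<exists>A. finite A \<and> (\<forall>a\<in>A. 0 < a) \<and> Gcd A = 1 \<and> \<Gamma> = generated A)"

definition minimal_generating_set :: "nat set \<Rightarrow> nat set \<Rightarrow> bool" where
  "minimal_generating_set \<Gamma> A \<longleftrightarrow>
     finite A \<and> generated A = \<Gamma> \<and> (\<forall>B. B \<subset> A \<longrightarrow> generated B \<noteq> \<Gamma>)"

definition arrangement :: "nat set \<Rightarrow> nat list \<Rightarrow> bool" where
  "arrangement \<Gamma> ns \<longleftrightarrow> distinct ns \<and> minimal_generating_set \<Gamma> (set ns)"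

text \<open>
  Arrangements \<open>(n\<^sub>1, \<dots>, n\<^sub>e)\<close> are lists, but the indices of \<open>n\<close>, \<open>d\<close> and \<open>c\<close> below start at 1.
  The value \<open>gen_d ns i\<close> is used only for \<open>2 \<le> i \<le> e + 1\<close>, and the division in \<open>gen_c\<close> is exact.
\<close>

definition gen_n :: "nat list \<Rightarrow> nat \<Rightarrow> nat" where
  "gen_n ns i = ns ! (i - 1)"

definition gen_d :: "nat list \<Rightarrow> nat \<Rightarrow> nat" where
  "gen_d ns i = Gcd (set (take (i - 1) ns))"

definition gen_c :: "nat list \<Rightarrow> nat \<Rightarrow> nat" where
  "gen_c ns i = gen_d ns i div gen_d ns (i + 1)"

definition free_numerical_semigroup :: "nat set \<Rightarrow> nat list \<Rightarrow> bool" where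
  "free_numerical_semigroup \<Gamma> ns \<longleftrightarrow>
     numerical_semigroup \<Gamma> \<and> arrangement \<Gamma> ns \<and>
     (\<forall>i\<in>{2..length ns}.
        gen_d ns i > gen_d ns (i + 1) \<and>
        gen_c ns i * gen_n ns i \<in> generated (set (take (i - 1) ns)))"

definition sg_multiplicity :: "nat set \<Rightarrow> nat" where
  "sg_multiplicity \<Gamma> = (LEAST x. x \<in> \<Gamma> \<and> 0 < x)"

definition conductor :: "nat set \<Rightarrow> nat" where
  "conductor \<Gamma> = (LEAST c. \<forall>x\<ge>c. x \<in> \<Gamma>)"

definition genus :: "nat set \<Rightarrow> nat" where
  "genus \<Gamma> = card (UNIV - \<Gamma>)"

text \<open>The condition \<open>c \<le> b\<close> excludes truncated subtraction, as \<open>\<Gamma>\<close> has no negative elements.\<close>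

definition divisors :: "nat set \<Rightarrow> nat \<Rightarrow> nat set" where
  "divisors \<Gamma> b = {c \<in> \<Gamma>. c \<le> b \<and> b - c \<in> \<Gamma>}"

definition feng_rao_distance2 :: "nat set \<Rightarrow> nat \<Rightarrow> nat" where
  "feng_rao_distance2 \<Gamma> a =
     Inf {card (divisors \<Gamma> b1 \<union> divisors \<Gamma> b2) | b1 b2.
            b1 \<in> \<Gamma> \<and> b2 \<in> \<Gamma> \<and> a \<le> b1 \<and> b1 < b2}"

text \<open>
  The second Feng-Rao number \<open>E(\<Gamma>, 2)\<close>: the constant in the eventual linear form
  of the second Feng-Rao distance.
\<close>

definition feng_rao_number2 :: "nat set \<Rightarrow> int" where
  "feng_rao_number2 \<Gamma> =
     (THE E. \<forall>a::nat. int a \<ge> 2 * int (conductor \<Gamma>) - 1 \<longrightarrow>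
        int (feng_rao_distance2 \<Gamma> a) = int a + 1 - 2 * int (genus \<Gamma>) + E)"

end

theory Submission imports Defs
begin

text \<open>
  For large \<open>b\<close>, the set \<open>D(b + x) - D(b)\<close> is in bijection with \<open>Ap(\<Gamma>, x)\<close> via
  \<open>y \<mapsto> b + x - y\<close>, so \<open>E(\<Gamma>, 2)\<close> is the least \<open>#Ap(\<Gamma>, x)\<close> over \<open>x > 0\<close>.

  Let \<open>S\<close> be generated by the first \<open>i - 1\<close> generators and \<open>T = S + n\<nat>\<close> with \<open>n = n\<^sub>i\<close>, \<open>c = c\<^sub>i\<close>.
  A multiple \<open>x\<close> of \<open>d\<^sub>i\<^sub>+\<^sub>1\<close> is uniquely \<open>k + l n\<close> with \<open>d\<^sub>i\<close> dividing \<open>k\<close> and \<open>0 \<le> l < c\<close>, and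
  \<open>#Ap(T, x) = (c - l) #Ap(S, k) + l #Ap(S, k + c n)\<close>. Hence \<open>B(x) = d\<^sub>i\<^sub>+\<^sub>1 #Ap(T, x)\<close> is a weighted
  mean of the corresponding two numbers for \<open>S\<close>. By induction \<open>B(x) \<ge> x\<close>, with equality on \<open>T\<close>,
  and \<open>B(x) \<ge> m(\<Gamma>)\<close> for \<open>x > 0\<close>: this is clear if \<open>k \<ge> 0\<close>, and if \<open>k < 0\<close> then
  \<open>B(x) \<ge> l (k + c n) / c > l (c - l) n / c \<ge> (c - 1) n / c\<close>, which is at least \<open>n\<^sub>1\<close> for \<open>i \<ge> 3\<close>.
  For \<open>i = 2\<close>, integrality of \<open>#Ap(T, x)\<close> improves this bound to \<open>min n\<^sub>1 n\<^sub>2\<close>.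
\<close>

section \<open>Apery sets when one generator is adjoined\<close>

text \<open>Semigroups become sets of integers here: \<open>u - x\<close> must not be truncated, and
  the part k in x = k + l n can be negative even for positive x.\<close>

definition apery :: "int set \<Rightarrow> int \<Rightarrow> int set" where
  "apery S x = {u \<in> S. u - x \<notin> S}"

definition adjoin :: "int set \<Rightarrow> int \<Rightarrow> int set" where
  "adjoin S n = {s + int j * n | s j. s \<in> S}"

lemma add_multiple_closed:
  fixes S :: "int set"
  assumes "\<forall>s\<in>S. \<forall>t\<in>S. s + t \<in> S" "b \<in> S" "s \<in> S"
  shows "s + int j * b \<in> S"
proof (induction j)
  case (Suc j)
  have "s + int (Suc j) * b = (s + int j * b) + b"
    by (simp add: algebra_simps)
  then show ?case using Suc assms by metis
qed (use assms in simp)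

text \<open>Writing d = g c and n = g t with g = gcd d n, the factors c and t are coprime. Two
  expansions of one number give c dvd (l' - l) t, so the digits agree modulo c and hence
  agree.\<close>

lemma gcd_digits_unique:
  fixes d n c :: int
  assumes "c * gcd d n = d" "d > 0"
    and "d dvd k - k'" "k + l * n = k' + l' * n"
    and "0 \<le> l" "l < c" "0 \<le> l'" "l' < c"
  shows "l = l'" "k = k'"
proof -
  let ?g = "gcd d n"
  have g: "?g > 0" using assms(2) by simp
  have "k - k' = (l' - l) * n" using assms(4) by (simp add: algebra_simps)
  then have "d dvd (l' - l) * n" using assms(3) by simp
  moreover obtain t where t: "n = ?g * t" by (meson dvdE gcd_dvd2)
  moreover have "coprime c t"
  proof -
    have "?g * gcd c t = ?g * 1"
      using gcd_mult_distrib_int[of ?g c t] assms(1) t g by (simp add: mult.commute)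
    then have "gcd c t = 1" using g by (metis mult_left_cancel less_irrefl)
    then show ?thesis by (simp add: coprime_iff_gcd_eq_1)
  qed
  ultimately have "?g * c dvd ?g * ((l' - l) * t)"
    using assms(1) by (metis mult.commute mult.left_commute)
  then have "c dvd (l' - l) * t" using g by (metis dvd_mult_cancel_left less_irrefl)
  then have "c dvd l' - l" using \<open>coprime c t\<close> coprime_dvd_mult_left_iff by blast
  then show "l = l'"
    using assms(5-8) zdvd_imp_le[of c "l' - l"] zdvd_imp_le[of c "l - l'"]
    by (smt (verit) dvd_minus_iff minus_diff_eq)
  then show "k = k'" using assms(4) by simp
qed

text \<open>A Bezout identity expresses x through d and n. The coefficient of n is then reduced
  modulo c; the removed multiple of c n is a multiple of d and is absorbed into k.\<close>

lemma gcd_digits_exist: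
  fixes d n c x :: int
  assumes "c * gcd d n = d" "d > 0" "gcd d n dvd x"
  obtains k l where "d dvd k" "0 \<le> l" "l < c" "x = k + l * n"
proof -
  obtain a b where ab: "a * d + b * n = gcd d n" using bezout_int by blast
  obtain q where q: "x = gcd d n * q" using assms(3) by blast
  have c: "c > 0" using assms(1,2) by (metis gcd_pos_int zero_less_mult_pos2 less_irrefl)
  obtain t where t: "n = gcd d n * t" by (meson dvdE gcd_dvd2)
  define l where "l = (b * q) mod c"
  have "c * n = d * t" using assms(1) t by (metis mult.assoc)
  have bq: "b * q = c * ((b * q) div c) + l" unfolding l_def by simp
  have "x = (a * d + b * n) * q" using q ab by simp
  also have "\<dots> = d * (a * q) + (b * q) * n" by (simp add: algebra_simps)
  also have "\<dots> = d * (a * q) + ((b * q) div c) * (c * n) + l * n"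
    by (subst bq) (simp add: algebra_simps)
  also have "\<dots> = d * (a * q + ((b * q) div c) * t) + l * n"
    using \<open>c * n = d * t\<close> by (simp add: algebra_simps)
  finally show ?thesis
    using that[of "d * (a * q + ((b * q) div c) * t)" l] c unfolding l_def by simp
qed

text \<open>Since c n lies in S, any c copies of n can be moved into the S-part, leaving a digit
  below c. Uniqueness of the expansion then identifies that S-part with k.\<close>

lemma adjoin_mem_iff:
  fixes d n c :: int
  assumes "c * gcd d n = d" "d > 0"
    and S: "\<forall>s\<in>S. \<forall>t\<in>S. s + t \<in> S" "\<forall>s\<in>S. d dvd s" "c * n \<in> S"
    and l: "d dvd k" "0 \<le> l" "l < c"
  shows "k + l * n \<in> adjoin S n \<longleftrightarrow> k \<in> S"
proof
  assume "k + l * n \<in> adjoin S n"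
  then obtain s j where s: "s \<in> S" "k + l * n = s + int j * n"
    unfolding adjoin_def by auto
  define q r where "q = int j div c" and "r = int j mod c"
  have j: "int j = q * c + r" and r: "0 \<le> r" "r < c" and "q \<ge> 0"
    using l by (auto simp: q_def r_def pos_imp_zdiv_nonneg_iff)
  define s' where "s' = s + int (nat q) * (c * n)"
  have "s' \<in> S" unfolding s'_def using add_multiple_closed S s(1) by blast
  moreover have "k + l * n = s' + r * n"
    using s(2) \<open>q \<ge> 0\<close> unfolding s'_def j by (simp add: algebra_simps)
  ultimately show "k \<in> S"
    using gcd_digits_unique(2)[OF assms(1,2), of k s' l r] l r S(2) by (auto intro: dvd_diff)
next
  assume "k \<in> S"
  then show "k + l * n \<in> adjoin S n"
    using l(2) unfolding adjoin_def by (auto intro!: exI[of _ k] exI[of _ "nat l"])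
qed

text \<open>The Apery set is sliced by the digit r of its elements. Subtracting k + l n from s + r n
  gives digit r - l if l <= r; otherwise c n is borrowed from the S-part, which amounts to replacing
  k by k + c n.\<close>

lemma apery_adjoin:
  fixes d n c :: int
  assumes "c * gcd d n = d" "d > 0"
    and S: "\<forall>s\<in>S. \<forall>t\<in>S. s + t \<in> S" "\<forall>s\<in>S. d dvd s" "c * n \<in> S"
    and l: "d dvd k" "0 \<le> l" "l < c"
  shows "apery (adjoin S n) (k + l * n) =
    (\<Union>r\<in>{0..<c}. (\<lambda>s. s + r * n) ` apery S (if l \<le> r then k else k + c * n))"
    (is "_ = ?R")
proof -
  note mem = adjoin_mem_iff[OF assms(1-5)]
  have dcn: "d dvd c * n" using S by blast
  have key: "s + r * n \<in> apery (adjoin S n) (k + l * n) \<longleftrightarrow>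
      s \<in> apery S (if l \<le> r then k else k + c * n)"
    if "d dvd s" "0 \<le> r" "r < c" for s r
  proof (cases "l \<le> r")
    case True
    have eq: "s + r * n - (k + l * n) = (s - k) + (r - l) * n" by (simp add: algebra_simps)
    show ?thesis
      unfolding apery_def mem_Collect_eq eq using mem[of s r] mem[of "s - k" "r - l"] that l True by auto
  next
    case False
    have eq: "s + r * n - (k + l * n) = (s - (k + c * n)) + (r - l + c) * n"
      by (simp add: algebra_simps)
    show ?thesis
      unfolding apery_def mem_Collect_eq eq using mem[of s r] mem[of "s - (k + c * n)" "r - l + c"] that l False dcn
      by auto
  qed
  show ?thesis
  proof (intro set_eqI iffI)
    fix u assume u: "u \<in> apery (adjoin S n) (k + l * n)"
    then obtain s j where "s \<in> S" "u = s + int j * n" unfolding apery_def adjoin_def by auto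
    then have "gcd d n dvd u"
      using S(2) by (meson dvd_add dvd_mult dvd_trans gcd_dvd1 gcd_dvd2)
    then obtain k' r where "d dvd k'" "0 \<le> r" "r < c" "u = k' + r * n"
      using gcd_digits_exist[OF assms(1,2)] by metis
    moreover from this have "k' \<in> apery S (if l \<le> r then k else k + c * n)" using u key by auto
    ultimately show "u \<in> ?R" by (intro UN_I[of r] image_eqI[of _ _ k']) auto
  next
    fix u assume "u \<in> ?R"
    then obtain r s where *: "0 \<le> r" "r < c" "u = s + r * n"
      "s \<in> apery S (if l \<le> r then k else k + c * n)" by fastforce
    moreover have "d dvd s" using *(4) S(2) unfolding apery_def by auto
    ultimately show "u \<in> apery (adjoin S n) (k + l * n)" using key by auto
  qed
qed

text \<open>The slices are disjoint by uniqueness of digits; the c - l digits r >= l see k, and the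
  l digits r < l see k + c n.\<close>

lemma card_apery_adjoin:
  fixes d n c :: int
  assumes "c * gcd d n = d" "d > 0"
    and S: "\<forall>s\<in>S. \<forall>t\<in>S. s + t \<in> S" "\<forall>s\<in>S. d dvd s" "c * n \<in> S"
    and l: "d dvd k" "0 \<le> l" "l < c"
    and fin: "finite (apery S k)" "finite (apery S (k + c * n))"
  shows "finite (apery (adjoin S n) (k + l * n))"
    and "int (card (apery (adjoin S n) (k + l * n))) =
      (c - l) * int (card (apery S k)) + l * int (card (apery S (k + c * n)))"
proof -
  define A where "A r = (\<lambda>s. s + r * n) ` apery S (if l \<le> r then k else k + c * n)" for r
  have eq: "apery (adjoin S n) (k + l * n) = (\<Union>r\<in>{0..<c}. A r)"
    unfolding A_def by (rule apery_adjoin[OF assms(1-8)])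
  have finA: "finite (A r)" for r unfolding A_def using fin by simp
  then show "finite (apery (adjoin S n) (k + l * n))" unfolding eq by simp
  have disj: "A r \<inter> A r' = {}" if "r \<in> {0..<c}" "r' \<in> {0..<c}" "r \<noteq> r'" for r r'
  proof (rule ccontr)
    assume "A r \<inter> A r' \<noteq> {}"
    then obtain s s' where "s \<in> S" "s' \<in> S" "s + r * n = s' + r' * n"
      unfolding A_def apery_def by auto
    then show False
      using gcd_digits_unique(1)[OF assms(1,2), of s s' r r'] that S(2) by (auto intro: dvd_diff)
  qed
  have cA: "int (card (A r)) =
      (if l \<le> r then int (card (apery S k)) else int (card (apery S (k + c * n))))" for r
    unfolding A_def by (subst card_image) (auto simp: inj_on_def)
  have "card (\<Union>r\<in>{0..<c}. A r) = (\<Sum>r\<in>{0..<c}. card (A r))"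
    using finA disj by (intro card_UN_disjoint) auto
  then have "int (card (\<Union>r\<in>{0..<c}. A r)) = (\<Sum>r\<in>{0..<c}. int (card (A r)))"
    by simp
  also have "(\<Sum>r\<in>{0..<c}. int (card (A r))) = (\<Sum>r\<in>{0..<l} \<union> {l..<c}. int (card (A r)))"
    using l by (simp add: ivl_disj_un_two(3))
  also have "\<dots> =
      (\<Sum>r\<in>{0..<l}. int (card (A r))) + (\<Sum>r\<in>{l..<c}. int (card (A r)))"
    by (rule sum.union_disjoint) auto
  also have "\<dots> = l * int (card (apery S (k + c * n))) + (c - l) * int (card (apery S k))"
    using l by (simp add: cA)
  finally show "int (card (apery (adjoin S n) (k + l * n))) =
      (c - l) * int (card (apery S k)) + l * int (card (apery S (k + c * n)))"
    unfolding eq by simp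
qed

section \<open>Regularity and lower bounds for Apery sets\<close>

text \<open>This is the invariant of the induction. Negative x are included because k may be
  negative and because finiteness at -1 later yields cofiniteness.\<close>

definition apery_regular :: "int set \<Rightarrow> int \<Rightarrow> bool" where
  "apery_regular S d \<longleftrightarrow> d > 0 \<and> (\<forall>s\<in>S. \<forall>t\<in>S. s + t \<in> S) \<and> (\<forall>s\<in>S. d dvd s) \<and>
     (\<forall>x. d dvd x \<longrightarrow> finite (apery S x) \<and> x \<le> d * int (card (apery S x)) \<and>
        (x \<in> S \<longrightarrow> d * int (card (apery S x)) = x))"

lemma apery_regular_multiples:
  assumes "n > 0"
  shows "apery_regular {int j * n | j. True} n"
proof -
  let ?S = "{int j * n | j. True}"
  have mem: "q * n \<in> ?S \<longleftrightarrow> q \<ge> 0" for q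
  proof
    assume "q \<ge> 0"
    then show "q * n \<in> ?S" by (auto intro!: exI[of _ "nat q"])
  qed (use assms in auto)
  have ap: "apery ?S (q * n) = (\<lambda>j. j * n) ` {0..<q}" for q
  proof (intro set_eqI iffI)
    fix u assume u: "u \<in> apery ?S (q * n)"
    then obtain j where j: "u = int j * n" unfolding apery_def by auto
    have "(int j - q) * n \<notin> ?S" using u unfolding apery_def j by (simp add: left_diff_distrib)
    then have "int j < q" unfolding mem by simp
    then show "u \<in> (\<lambda>j. j * n) ` {0..<q}" using j by auto
  next
    fix u assume "u \<in> (\<lambda>j. j * n) ` {0..<q}"
    then obtain j where j: "u = j * n" "0 \<le> j" "j < q" by (metis atLeastLessThan_iff imageE)
    moreover have "u - q * n = (j - q) * n" using j by (simp add: left_diff_distrib)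
    ultimately show "u \<in> apery ?S (q * n)"
      unfolding apery_def using mem[of j] mem[of "j - q"] by simp
  qed
  have card: "int (card (apery ?S (q * n))) = max q 0" for q
    unfolding ap using assms by (subst card_image) (auto simp: inj_on_def)
  have "s + t \<in> ?S" if "s \<in> ?S" "t \<in> ?S" for s t
  proof -
    obtain i j where "s = int i * n" "t = int j * n"
      using \<open>s \<in> ?S\<close> \<open>t \<in> ?S\<close> by auto
    then show ?thesis by (auto intro!: exI[of _ "i + j"] simp: algebra_simps)
  qed
  moreover have "finite (apery ?S x) \<and> x \<le> n * int (card (apery ?S x)) \<and>
      (x \<in> ?S \<longrightarrow> n * int (card (apery ?S x)) = x)" if "n dvd x" for x
  proof -
    obtain q where q: "x = q * n" using \<open>n dvd x\<close> by (metis dvdE mult.commute)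
    have "finite (apery ?S x)" unfolding q ap by simp
    then show ?thesis
      unfolding q card mem using assms by (simp add: mult.commute max_def)
  qed
  ultimately show ?thesis unfolding apery_regular_def using assms by auto
qed

text \<open>With B the scaled cardinality, c B(x) and c x are the same combination, with weights c -
  l and l, of the values of B at k and k + c n and of these two numbers themselves. The inequality
  therefore carries over. For x in the larger semigroup both numbers lie in S, so equality carries
  over too.\<close>

lemma apery_regular_adjoin:
  fixes d n c :: int
  assumes "apery_regular S d" "c * gcd d n = d" "c * n \<in> S"
  shows "apery_regular (adjoin S n) (gcd d n)"
proof -
  have d: "d > 0" and S: "\<forall>s\<in>S. \<forall>t\<in>S. s + t \<in> S" "\<forall>s\<in>S. d dvd s"
    and R: "\<And>x. d dvd x \<Longrightarrow> finite (apery S x)" "\<And>x. d dvd x \<Longrightarrow> x \<le> d * int (card (apery S x))"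
      "\<And>x. d dvd x \<Longrightarrow> x \<in> S \<Longrightarrow> d * int (card (apery S x)) = x"
    using assms(1) unfolding apery_regular_def by auto
  let ?g = "gcd d n"
  have g: "?g > 0" using d by simp
  have c: "c > 0" using assms(2) d g by (metis zero_less_mult_pos2)
  have dcn: "d dvd c * n" using S assms(3) by blast
  have main: "finite (apery (adjoin S n) x)" "x \<le> ?g * int (card (apery (adjoin S n) x))"
    "x \<in> adjoin S n \<Longrightarrow> ?g * int (card (apery (adjoin S n) x)) = x" if "?g dvd x" for x
  proof -
    obtain k l where l: "d dvd k" "0 \<le> l" "l < c" and x: "x = k + l * n"
      using gcd_digits_exist[OF assms(2) d \<open>?g dvd x\<close>] .
    have dk: "d dvd k + c * n" using l(1) dcn by simp
    note fc = card_apery_adjoin[OF assms(2) d S assms(3) l R(1)[OF l(1)] R(1)[OF dk]]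
    show "finite (apery (adjoin S n) x)" unfolding x by (rule fc(1))
    let ?A = "int (card (apery S k))" and ?B = "int (card (apery S (k + c * n)))"
    have cg: "c * (?g * int (card (apery (adjoin S n) x))) = (c - l) * (d * ?A) + l * (d * ?B)"
    proof -
      have "c * (?g * int (card (apery (adjoin S n) x))) = d * ((c - l) * ?A + l * ?B)"
        unfolding x fc(2) mult.assoc[symmetric] assms(2) ..
      then show ?thesis by (simp add: algebra_simps)
    qed
    have cx: "c * x = (c - l) * k + l * (k + c * n)" unfolding x by (simp add: algebra_simps)
    have "c * x \<le> c * (?g * int (card (apery (adjoin S n) x)))"
      unfolding cg cx using R(2)[OF l(1)] R(2)[OF dk] l by (intro add_mono mult_left_mono) auto
    then show "x \<le> ?g * int (card (apery (adjoin S n) x))" using c by simp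
    assume "x \<in> adjoin S n"
    then have "k \<in> S" using adjoin_mem_iff[OF assms(2) d S assms(3) l] x by simp
    then have "k + c * n \<in> S" using S assms(3) by blast
    then have "c * (?g * int (card (apery (adjoin S n) x))) = c * x"
      unfolding cg cx using R(3) \<open>k \<in> S\<close> l(1) dk by simp
    then show "?g * int (card (apery (adjoin S n) x)) = x" using c by simp
  qed
  have "s + t \<in> adjoin S n" if "s \<in> adjoin S n" "t \<in> adjoin S n" for s t
  proof -
    obtain s' i t' j where "s' \<in> S" "s = s' + int i * n" "t' \<in> S" "t = t' + int j * n"
      using \<open>s \<in> _\<close> \<open>t \<in> _\<close> unfolding adjoin_def by auto
    then have "s' + t' \<in> S" "s + t = (s' + t') + int (i + j) * n"
      using S by (auto simp: algebra_simps)
    then show ?thesis unfolding adjoin_def by blast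
  qed
  moreover have "?g dvd s" if "s \<in> adjoin S n" for s
  proof -
    obtain s' i where "s' \<in> S" "s = s' + int i * n" using \<open>s \<in> _\<close> unfolding adjoin_def by auto
    then show ?thesis using S(2) by (meson dvd_add dvd_mult dvd_trans gcd_dvd1 gcd_dvd2)
  qed
  ultimately show ?thesis unfolding apery_regular_def using g main by blast
qed

text \<open>
  The second alternative is the case \<open>k < 0\<close>, where the \<open>card (apery S k)\<close> term is dropped.
\<close>

lemma apery_adjoin_lower_bound:
  fixes d n c m x :: int
  assumes "apery_regular S d" "c * gcd d n = d" "c * n \<in> S" "n \<ge> 0" "m \<le> n"
    and m: "\<And>y. d dvd y \<Longrightarrow> y > 0 \<Longrightarrow> m \<le> d * int (card (apery S y))"
    and x: "gcd d n dvd x" "x > 0"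
  shows "m \<le> gcd d n * int (card (apery (adjoin S n) x)) \<or>
    gcd d n + (c - 1) * n \<le> c * (gcd d n * int (card (apery (adjoin S n) x)))"
proof -
  have d: "d > 0" and S: "\<forall>s\<in>S. \<forall>t\<in>S. s + t \<in> S" "\<forall>s\<in>S. d dvd s"
    and R: "\<And>x. d dvd x \<Longrightarrow> finite (apery S x)" "\<And>x. d dvd x \<Longrightarrow> x \<le> d * int (card (apery S x))"
    using assms(1) unfolding apery_regular_def by auto
  let ?g = "gcd d n"
  have g: "?g > 0" using d by simp
  have c: "c > 0" using assms(2) d g by (metis zero_less_mult_pos2)
  have dcn: "d dvd c * n" using S assms(3) by blast
  obtain k l where l: "d dvd k" "0 \<le> l" "l < c" and xk: "x = k + l * n"
    using gcd_digits_exist[OF assms(2) d x(1)] .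
  have dk: "d dvd k + c * n" using l(1) dcn by simp
  note fc = card_apery_adjoin[OF assms(2) d S assms(3) l R(1)[OF l(1)] R(1)[OF dk]]
  let ?A = "int (card (apery S k))" and ?B = "int (card (apery S (k + c * n)))"
  define X where "X = ?g * int (card (apery (adjoin S n) x))"
  have cX: "c * X = (c - l) * (d * ?A) + l * (d * ?B)"
  proof -
    have "c * X = d * ((c - l) * ?A + l * ?B)"
      unfolding X_def xk fc(2) mult.assoc[symmetric] assms(2) ..
    then show ?thesis by (simp add: algebra_simps)
  qed
  have A0: "0 \<le> (c - l) * (d * ?A)" using l d by simp
  have B0: "l * (k + c * n) \<le> l * (d * ?B)" using R(2)[OF dk] l by (intro mult_left_mono) auto
  consider "k > 0" | "k = 0" | "k < 0" by linarith
  then have "m \<le> X \<or> ?g + (c - 1) * n \<le> c * X"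
  proof cases
    case 1
    have "k + c * n > 0" using 1 c assms(4) by (simp add: add_pos_nonneg)
    then have "(c - l) * m + l * m \<le> c * X"
      unfolding cX using m[OF l(1) 1] m[OF dk] l by (intro add_mono mult_left_mono) auto
    then have "c * m \<le> c * X" by (simp add: algebra_simps)
    then show ?thesis using c by simp
  next
    case 2
    then have "l > 0" using x(2) xk l by (cases "l = 0") auto
    \<comment> \<open>The bound \<open>m\<close> is only available at positive arguments, so at k =
      0 the regularity bound at c n alone carries the estimate.\<close>
    have "c * (l * n) \<le> c * X" using A0 B0 cX 2 by (simp add: algebra_simps)
    then have "l * n \<le> X" using c by simp
    moreover have "1 * n \<le> l * n" using \<open>l > 0\<close> assms(4) by (intro mult_right_mono) auto
    ultimately show ?thesis using assms(5) by linarith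
  next
    case 3
    then have "l > 0" using x(2) xk l by (cases "l = 0") auto
    \<comment> \<open>Divisibility sharpens x > 0. This surplus is what makes the integrality
      argument for two generators succeed.\<close>
    have "?g \<le> x" using x zdvd_imp_le by blast
    also have "1 * x \<le> l * x" using \<open>l > 0\<close> x(2) by (intro mult_right_mono) auto
    finally have "?g \<le> l * x" by simp
    moreover have "(c - 1) * n \<le> (l * (c - l)) * n"
    proof (rule mult_right_mono)
      \<comment> \<open>The product expands to l (c - l) - (c - 1), the excess over the value taken
        at l = 1 and l = c - 1.\<close>
      have "0 \<le> (l - 1) * (c - l - 1)" using \<open>l > 0\<close> l by simp
      then show "c - 1 \<le> l * (c - l)" by (simp add: algebra_simps)
    qed (use assms in simp)
    moreover have "l * (k + c * n) = l * x + (l * (c - l)) * n"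
      unfolding xk by (simp add: algebra_simps)
    ultimately show ?thesis using A0 B0 cX by linarith
  qed
  then show ?thesis unfolding X_def .
qed

text \<open>Put n1 = g c and n2 = g t. Dividing by g gives 1 + (c - 1) t <= c A. If A <= t - 1 and A
  <= c - 1, then c A = (c - 1) A + A <= (c - 1) t, a contradiction. So g A reaches n2 or n1.\<close>

lemma apery_two_generators_bound:
  fixes n1 n2 c m A :: int
  assumes "c * gcd n1 n2 = n1" "n1 > 0" "m \<le> n1" "m \<le> n2"
    and "gcd n1 n2 + (c - 1) * n2 \<le> c * (gcd n1 n2 * A)"
  shows "m \<le> gcd n1 n2 * A"
proof -
  let ?g = "gcd n1 n2"
  have g: "?g > 0" using assms(2) by simp
  have c: "c > 0" using assms(1,2) g by (metis zero_less_mult_pos2)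
  obtain t where t: "n2 = ?g * t" by (meson dvdE gcd_dvd2)
  have "?g + (c - 1) * (?g * t) \<le> c * (?g * A)" using assms(5) t by metis
  then have "?g * (1 + (c - 1) * t) \<le> ?g * (c * A)" by (simp add: algebra_simps)
  then have *: "1 + (c - 1) * t \<le> c * A" using g by simp
  have "t \<le> A \<or> c \<le> A"
  proof (rule ccontr)
    assume "\<not> (t \<le> A \<or> c \<le> A)"
    then have "(c - 1) * A \<le> (c - 1) * (t - 1)" "A \<le> c - 1" using c by (auto intro: mult_left_mono)
    then show False using * by (simp add: algebra_simps)
  qed
  then show ?thesis
  proof
    assume "t \<le> A"
    then have "n2 \<le> ?g * A" using t g by (metis mult_left_mono less_imp_le)
    then show ?thesis using assms by simp
  next
    assume "c \<le> A"
    then have "n1 \<le> ?g * A" using assms(1) g by (metis mult_left_mono less_imp_le mult.commute)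
    then show ?thesis using assms by simp
  qed
qed

section \<open>Generated semigroups and their integer images\<close>

lemma generated_empty: "generated {} = {0}"
  unfolding generated_def by auto

lemma generated_insert:
  assumes "finite A" "n \<notin> A"
  shows "generated (insert n A) = {s + j * n | s j. s \<in> generated A}"
proof (intro set_eqI iffI)
  fix x assume "x \<in> generated (insert n A)"
  then obtain k where "x = (\<Sum>a\<in>insert n A. k a * a)" unfolding generated_def by auto
  then have "x = (\<Sum>a\<in>A. k a * a) + k n * n" using assms by simp
  then show "x \<in> {s + j * n | s j. s \<in> generated A}" unfolding generated_def by blast
next
  fix x assume "x \<in> {s + j * n | s j. s \<in> generated A}"
  then obtain k j where x: "x = (\<Sum>a\<in>A. k a * a) + j * n" unfolding generated_def by auto
  have "(\<Sum>a\<in>A. (k(n := j)) a * a) = (\<Sum>a\<in>A. k a * a)"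
    using assms by (intro sum.cong) auto
  then have "x = (\<Sum>a\<in>insert n A. (k(n := j)) a * a)" using assms x by simp
  then show "x \<in> generated (insert n A)" unfolding generated_def by blast
qed

lemma generated_superset:
  assumes "finite A"
  shows "A \<subseteq> generated A"
proof
  fix n assume "n \<in> A"
  then have "generated A = {s + j * n | s j. s \<in> generated (A - {n})}"
    using generated_insert[of "A - {n}" n] assms by (simp add: insert_absorb)
  moreover have "0 \<in> generated (A - {n})"
    unfolding generated_def by (auto intro!: exI[of _ "\<lambda>_. 0"])
  ultimately show "n \<in> generated A" by (metis (mono_tags, lifting) CollectI add_0 mult_1)
qed

lemma Gcd_dvd_generated: "x \<in> generated A \<Longrightarrow> Gcd A dvd x"
  unfolding generated_def by (auto intro!: dvd_sum dvd_mult)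

lemma int_generated_insert:
  assumes "finite A" "n \<notin> A"
  shows "int ` generated (insert n A) = adjoin (int ` generated A) (int n)"
  unfolding generated_insert[OF assms] adjoin_def by (force simp: image_iff)

lemma int_generated_singleton: "int ` generated {n} = {int j * int n | j. True}"
  using generated_insert[of "{}" n] by (force simp: generated_empty image_iff)

section \<open>Induction along the arrangement\<close>

text \<open>Both claims are carried together, since the lower bound after adjoining a generator
  rests on regularity before it. Note that \<open>gen_d ns (i + 1)\<close> is the gcd of the first
  \<open>i\<close> generators.\<close>

lemma free_apery_bound:
  assumes ns: "distinct ns"
    and free: "\<forall>i\<in>{2..length ns}. gen_d ns i > gen_d ns (i + 1) \<and>
        gen_c ns i * gen_n ns i \<in> generated (set (take (i - 1) ns))"
    and large: "\<forall>i\<in>{3..length ns}. gen_c ns i * gen_n ns 1 \<le> (gen_c ns i - 1) * gen_n ns i"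
    and m: "\<forall>a\<in>set ns. 0 < a \<and> m \<le> a"
    and i: "1 \<le> i" "i \<le> length ns"
  shows "apery_regular (int ` generated (set (take i ns))) (int (gen_d ns (i + 1))) \<and>
    (\<forall>x>0. int (gen_d ns (i + 1)) dvd x \<longrightarrow>
      int m \<le> int (gen_d ns (i + 1)) * int (card (apery (int ` generated (set (take i ns))) x)))"
  using i
proof (induction i rule: nat_induct_at_least)
  case base
  then obtain n ns' where n: "ns = n # ns'" by (cases ns) auto
  have d: "gen_d ns 2 = n" unfolding gen_d_def n by simp
  have n0: "n > 0" "m \<le> n" using m n by auto
  have R: "apery_regular (int ` generated {n}) (int n)"
    unfolding int_generated_singleton using n0 by (intro apery_regular_multiples) simp
  moreover have "int m \<le> int n * int (card (apery (int ` generated {n}) x))"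
    if "x > 0" "int n dvd x" for x
  proof -
    have "int m \<le> x" using that n0 zdvd_imp_le by fastforce
    also have "x \<le> int n * int (card (apery (int ` generated {n}) x))"
      using R that unfolding apery_regular_def by blast
    finally show ?thesis .
  qed
  ultimately show ?case using d n by (simp add: numeral_2_eq_2)
next
  case (Suc i)
  define n where "n = gen_n ns (Suc i)"
  define d where "d = gen_d ns (Suc i)"
  define c where "c = gen_c ns (Suc i)"
  define S where "S = int ` generated (set (take i ns))"
  have i: "i < length ns" and n': "n = ns ! i" using Suc.prems unfolding n_def gen_n_def by auto
  have tk: "take (Suc i) ns = take i ns @ [n]" unfolding n' using i by (simp add: take_Suc_conv_app_nth)
  have nn: "n \<notin> set (take i ns)"
    using distinct_take[OF ns, of "Suc i"] unfolding tk by simp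
  have S': "int ` generated (set (take (Suc i) ns)) = adjoin S (int n)"
    unfolding tk S_def using int_generated_insert[OF _ nn] by simp
  have g: "gen_d ns (Suc i + 1) = gcd d n"
    unfolding d_def gen_d_def using tk by (simp add: gcd.commute)
  have IH: "apery_regular S (int d)"
    "\<And>x. int d dvd x \<Longrightarrow> x > 0 \<Longrightarrow> int m \<le> int d * int (card (apery S x))"
    using Suc unfolding S_def d_def by auto
  have n0: "0 < n" "m \<le> n" using m i unfolding n' by auto
  have cd: "c * gcd d n = d"
    unfolding c_def gen_c_def g d_def[symmetric] by simp
  have cn: "c * n \<in> generated (set (take i ns))"
    using free[rule_format, of "Suc i"] Suc.prems Suc.hyps unfolding c_def n_def by auto
  have cdi: "int c * gcd (int d) (int n) = int d" using cd by (metis of_nat_mult gcd_int_int_eq)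
  have cni: "int c * int n \<in> S" unfolding S_def using cn by (metis image_eqI of_nat_mult)
  have gi: "int (gen_d ns (Suc i + 1)) = gcd (int d) (int n)" unfolding g by (simp add: gcd_int_int_eq)
  have "int m \<le> gcd (int d) (int n) * int (card (apery (adjoin S (int n)) x))"
    if x: "x > 0" "gcd (int d) (int n) dvd x" for x
  proof -
    let ?g = "gcd (int d) (int n)" and ?A = "int (card (apery (adjoin S (int n)) x))"
    from apery_adjoin_lower_bound[OF IH(1) cdi cni _ _ IH(2) x(2,1)] n0
    consider "int m \<le> ?g * ?A" | "?g + (int c - 1) * int n \<le> int c * (?g * ?A)"
      by auto
    then show ?thesis
    proof cases
      case 2
      have d0: "int d > 0" using IH(1) unfolding apery_regular_def by simp
      have "ns ! 0 \<in> set ns" using i by (intro nth_mem) linarith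
      then have m1: "m \<le> gen_n ns 1" using m unfolding gen_n_def by simp
      show ?thesis
      proof (cases "i = 1")
        case True
        \<comment> \<open>The size hypothesis starts at index 3. For the second generator d is n_1
          itself, and integrality takes its place.\<close>
        have "d = gen_n ns 1"
          unfolding d_def gen_d_def gen_n_def True using i by (cases ns) auto
        then show ?thesis using apery_two_generators_bound[OF cdi d0 _ _ 2] m1 n0 by simp
      next
        case False
        have c0: "c > 0" using cd d0 by (cases c) auto
        have "c * gen_n ns 1 \<le> (c - 1) * n"
          using large[rule_format, of "Suc i"] False Suc.hyps Suc.prems unfolding c_def n_def by auto
        then have "int c * int (gen_n ns 1) \<le> (int c - 1) * int n"
          using c0 by (metis of_nat_mono of_nat_mult of_nat_diff of_nat_1 Suc_leI One_nat_def)
        then have "int c * int (gen_n ns 1) \<le> int c * (?g * ?A)"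
          using 2 d0 by (smt (verit) gcd_ge_0_int)
        then have "int (gen_n ns 1) \<le> ?g * ?A" using c0 by simp
        then show ?thesis using m1 by linarith
      qed
    qed
  qed
  then show ?case
    unfolding S' gi using apery_regular_adjoin[OF IH(1) cdi cni] by blast
qed

section \<open>Feng-Rao distances and Apery sets\<close>

text \<open>The interval from 0 to b splits into D(b), the gaps x and their reflections b - x. Gaps
  are below c, and b >= 2c - 1 puts their reflections at c or above, so the two copies of the gaps
  are disjoint.\<close>

lemma card_divisors:
  assumes c: "\<forall>x\<ge>c. x \<in> \<Gamma>" and b: "2 * int c - 1 \<le> int b"
  shows "int (card (divisors \<Gamma> b)) = int b + 1 - 2 * int (genus \<Gamma>)"
proof -
  let ?G = "UNIV - \<Gamma>"
  have G: "x < c" "x \<le> b" if "x \<notin> \<Gamma>" for x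
  proof -
    show "x < c" using c that not_le by blast
    then show "x \<le> b" using b by linarith
  qed
  have fin: "finite ?G" by (rule finite_subset[of _ "{..<c}"]) (use G in auto)
  let ?G' = "(\<lambda>x. b - x) ` ?G"
  have eq: "{..b} = divisors \<Gamma> b \<union> (?G \<union> ?G')"
  proof (intro set_eqI iffI)
    fix x assume x: "x \<in> {..b}"
    show "x \<in> divisors \<Gamma> b \<union> (?G \<union> ?G')"
    proof (cases "b - x \<in> \<Gamma>")
      case False
      then have "x \<in> ?G'" using x by (intro image_eqI[of _ _ "b - x"]) auto
      then show ?thesis by simp
    qed (use x in \<open>auto simp: divisors_def\<close>)
  qed (use G in \<open>auto simp: divisors_def\<close>)
  have "?G \<inter> ?G' = {}"
  proof (rule ccontr)
    assume "?G \<inter> ?G' \<noteq> {}"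
    then obtain x where "x \<notin> \<Gamma>" "b - x \<notin> \<Gamma>" "x \<le> b" using G by fastforce
    then show False using G(1)[of x] G(1)[of "b - x"] b by linarith
  qed
  then have "card (?G \<union> ?G') = card ?G + card ?G'" using fin by (intro card_Un_disjoint) auto
  moreover have "card ?G' = card ?G"
  proof (intro card_image inj_onI)
    fix x y assume "x \<in> ?G" "y \<in> ?G" "b - x = b - y"
    then show "x = y" using G(2)[of x] G(2)[of y] by simp
  qed
  moreover have "divisors \<Gamma> b \<inter> (?G \<union> ?G') = {}" using G by (auto simp: divisors_def)
  then have "card {..b} = card (divisors \<Gamma> b) + card (?G \<union> ?G')"
    unfolding eq using fin by (intro card_Un_disjoint) (auto simp: divisors_def)
  ultimately show ?thesis unfolding genus_def by simp
qed

text \<open>Under u = b + x - y, the failure of b - y to lie in the semigroup becomes the Apery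
  condition on u. Conversely an Apery element v is below x + c, so b + x - v is at least c and lies
  in the semigroup automatically.\<close>

lemma card_divisors_Un:
  assumes c: "\<forall>x\<ge>c. x \<in> \<Gamma>" and b: "2 * int c - 1 \<le> int b" and x: "x > 0"
  shows "int (card (divisors \<Gamma> b \<union> divisors \<Gamma> (b + x))) =
    int b + 1 - 2 * int (genus \<Gamma>) + int (card (apery (int ` \<Gamma>) (int x)))"
proof -
  let ?D = "divisors \<Gamma> (b + x) - divisors \<Gamma> b"
  have "bij_betw (\<lambda>y. int (b + x) - int y) ?D (apery (int ` \<Gamma>) (int x))"
  proof (rule bij_betwI')
    fix y assume "y \<in> ?D"
    then have y: "y \<in> \<Gamma>" "y \<le> b + x" "b + x - y \<in> \<Gamma>" "\<not> (y \<le> b \<and> b - y \<in> \<Gamma>)"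
      by (auto simp: divisors_def)
    have "int (b + x) - int y = int (b + x - y)" using y(2) by simp
    then have "int (b + x) - int y \<in> int ` \<Gamma>" using y(3) by blast
    moreover have "int (b + x) - int y - int x \<notin> int ` \<Gamma>"
    proof
      assume "int (b + x) - int y - int x \<in> int ` \<Gamma>"
      then obtain z where z: "z \<in> \<Gamma>" "int b - int y = int z" by auto
      then have "y \<le> b" "z = b - y" by linarith+
      then show False using z y by simp
    qed
    ultimately show "int (b + x) - int y \<in> apery (int ` \<Gamma>) (int x)" unfolding apery_def by simp
  next
    fix u assume "u \<in> apery (int ` \<Gamma>) (int x)"
    then obtain v where v: "v \<in> \<Gamma>" "u = int v" "int v - int x \<notin> int ` \<Gamma>"
      unfolding apery_def by auto
    have "v < x + c"
    proof (rule ccontr)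
      assume "\<not> v < x + c"
      then have "v - x \<in> \<Gamma>" "int v - int x = int (v - x)" using c by auto
      then show False using v(3) by (metis image_eqI)
    qed
    then have le: "v \<le> b + x" and "b + x - v \<ge> c" using b by linarith+
    then have "b + x - v \<in> \<Gamma>" using c by blast
    moreover have "\<not> (b + x - v \<le> b \<and> b - (b + x - v) \<in> \<Gamma>)"
    proof
      assume *: "b + x - v \<le> b \<and> b - (b + x - v) \<in> \<Gamma>"
      then have "int v - int x = int (b - (b + x - v))" using le by linarith
      then show False using v(3) * by (metis image_eqI)
    qed
    ultimately have "b + x - v \<in> ?D" using v(1) le by (auto simp: divisors_def)
    moreover have "u = int (b + x) - int (b + x - v)" using v(2) le by simp
    ultimately show "\<exists>y\<in>?D. u = int (b + x) - int y" by blast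
  qed auto
  then have "card ?D = card (apery (int ` \<Gamma>) (int x))" by (rule bij_betw_same_card)
  moreover have "card (divisors \<Gamma> b \<union> divisors \<Gamma> (b + x)) = card (divisors \<Gamma> b) + card ?D"
    by (subst card_Un_disjoint[symmetric]) (auto simp: divisors_def intro: arg_cong[of _ _ card])
  ultimately show ?thesis using card_divisors[OF c b] by simp
qed

text \<open>The pair (a, a + x0) is optimal: a larger b1 increases the linear term, and any other
  difference b2 - b1 has an Apery set of at least m elements.\<close>

lemma feng_rao_number2_eq_min_card_apery:
  assumes cofinite: "\<exists>c. \<forall>x\<ge>c. x \<in> \<Gamma>"
    and lower: "\<And>x. x > 0 \<Longrightarrow> m \<le> card (apery (int ` \<Gamma>) (int x))"
    and attained: "x0 > 0" "card (apery (int ` \<Gamma>) (int x0)) = m"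
  shows "feng_rao_number2 \<Gamma> = int m"
proof -
  define c where "c = conductor \<Gamma>"
  have c: "\<forall>x\<ge>c. x \<in> \<Gamma>"
    unfolding c_def conductor_def using cofinite by (rule LeastI_ex)
  have dist: "int (feng_rao_distance2 \<Gamma> a) = int a + 1 - 2 * int (genus \<Gamma>) + int m"
    if a: "int a \<ge> 2 * int c - 1" for a
  proof -
    let ?X = "{card (divisors \<Gamma> b1 \<union> divisors \<Gamma> b2) | b1 b2.
            b1 \<in> \<Gamma> \<and> b2 \<in> \<Gamma> \<and> a \<le> b1 \<and> b1 < b2}"
    let ?v = "card (divisors \<Gamma> a \<union> divisors \<Gamma> (a + x0))"
    have v: "int ?v = int a + 1 - 2 * int (genus \<Gamma>) + int m"
      using card_divisors_Un[OF c a attained(1)] attained(2) by simp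
    have "a \<ge> c" using a by linarith
    then have "a \<in> \<Gamma>" "a + x0 \<in> \<Gamma>" using c by auto
    then have "?v \<in> ?X" using attained(1) by fastforce
    moreover have "?v \<le> y" if "y \<in> ?X" for y
    proof -
      obtain b1 b2 where y: "y = card (divisors \<Gamma> b1 \<union> divisors \<Gamma> b2)" "a \<le> b1" "b1 < b2"
        using \<open>y \<in> ?X\<close> by blast
      define x where "x = b2 - b1"
      have x: "x > 0" "b2 = b1 + x" using y(3) unfolding x_def by auto
      have "2 * int c - 1 \<le> int b1" using a y(2) by linarith
      from card_divisors_Un[OF c this x(1)] lower[OF x(1)] v y(1,2) x(2) show ?thesis by simp
    qed
    ultimately have "Inf ?X = ?v" by (intro cInf_eq_minimum) auto
    then show ?thesis unfolding feng_rao_distance2_def using v by simp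
  qed
  show ?thesis
    unfolding feng_rao_number2_def c_def[symmetric]
  proof (rule the_equality)
    fix E assume E: "\<forall>a. int a \<ge> 2 * int c - 1 \<longrightarrow>
      int (feng_rao_distance2 \<Gamma> a) = int a + 1 - 2 * int (genus \<Gamma>) + E"
    \<comment> \<open>One admissible argument, here 2c, already determines the constant.\<close>
    then show "E = int m" using E[rule_format, of "2 * c"] dist[of "2 * c"] by simp
  qed (use dist in blast)
qed

text \<open>The Apery set at -1 consists of the elements whose successor is missing. Beyond the last
  of them, membership propagates from any element to all larger numbers.\<close>

lemma cofinite_if_finite_apery:
  assumes "finite (apery (int ` \<Gamma>) (- 1))" "infinite \<Gamma>"
  shows "\<exists>c. \<forall>x\<ge>c. x \<in> \<Gamma>"
proof -
  have "finite {v \<in> \<Gamma>. Suc v \<notin> \<Gamma>}"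
  proof (rule finite_imageD[of int])
    have "int ` {v \<in> \<Gamma>. Suc v \<notin> \<Gamma>} \<subseteq> apery (int ` \<Gamma>) (- 1)"
      by (auto simp: apery_def image_iff) (metis int_Suc nat_int add.commute)
    then show "finite (int ` {v \<in> \<Gamma>. Suc v \<notin> \<Gamma>})" using assms(1) finite_subset by blast
  qed simp
  then obtain N where N: "\<And>v. v \<in> \<Gamma> \<Longrightarrow> Suc v \<notin> \<Gamma> \<Longrightarrow> v < N"
    unfolding finite_nat_set_iff_bounded by auto
  obtain c where c: "c \<in> \<Gamma>" "c \<ge> N" using assms(2) finite_nat_set_iff_bounded by (metis not_less)
  have "x \<in> \<Gamma>" if "x \<ge> c" for x
    using that by (induction x rule: dec_induct) (use c N in \<open>force+\<close>)
  then show ?thesis by blast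
qed

section \<open>From the generators to the multiplicity\<close>

theorem theorem20:
  fixes \<Gamma> :: "nat set" and ns :: "nat list"
  assumes "free_numerical_semigroup \<Gamma> ns"
    and "\<forall>i\<in>{3..length ns}.
           (real (gen_c ns i) - 1) / real (gen_c ns i) * real (gen_n ns i) \<ge> real (gen_n ns 1)"
  shows "feng_rao_number2 \<Gamma> = int (sg_multiplicity \<Gamma>)"
proof -
  have dist: "distinct ns" and gen: "generated (set ns) = \<Gamma>"
    and free: "\<forall>i\<in>{2..length ns}. gen_d ns i > gen_d ns (i + 1) \<and>
        gen_c ns i * gen_n ns i \<in> generated (set (take (i - 1) ns))"
    and "numerical_semigroup \<Gamma>"
    using assms(1) unfolding free_numerical_semigroup_def arrangement_def minimal_generating_set_def
    by auto
  then obtain A where A: "finite A" "Gcd A = 1" "\<Gamma> = generated A"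
    unfolding numerical_semigroup_def by auto
  \<comment> \<open>The coprime generating set \<open>A\<close> may differ from \<open>ns\<close>,
    but its elements are sums of entries of \<open>ns\<close>.\<close>
  have "Gcd (set ns) dvd Gcd A"
    using Gcd_dvd_generated generated_superset[OF A(1)] A(3) gen by (intro Gcd_greatest) auto
  then have gcd1: "Gcd (set ns) = 1" using A(2) by simp
  have ne: "ns \<noteq> []" using gcd1 by auto
  have d1: "gen_d ns (length ns + 1) = 1" unfolding gen_d_def using gcd1 by simp
  \<comment> \<open>Adjoining 0 leaves the gcd unchanged, so strict descent allows 0 only in first
    place. Then d_2 = 0, which contradicts either a final gcd of 1 or the descent from d_2.\<close>
  have pos: "a > 0" if "a \<in> set ns" for a
  proof (rule ccontr)
    assume "\<not> a > 0"
    then obtain i where i: "i < length ns" "ns ! i = 0" using \<open>a \<in> set ns\<close> by (auto simp: in_set_conv_nth)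
    have "gen_d ns (i + 2) = gen_d ns (i + 1)"
      unfolding gen_d_def using i by (simp add: take_Suc_conv_app_nth)
    then have "i = 0" using free[rule_format, of "i + 1"] i by (cases "i = 0") auto
    then have "gen_d ns 2 = 0"
      unfolding gen_d_def using i by (simp add: take_Suc_conv_app_nth)
    then show False
      using free[rule_format, of 2] d1 i by (cases "length ns = 1") (auto simp: numeral_2_eq_2)
  qed
  define m where "m = sg_multiplicity \<Gamma>"
  have sub: "set ns \<subseteq> \<Gamma>" using generated_superset[of "set ns"] gen by simp
  have m_le: "\<forall>a\<in>set ns. 0 < a \<and> m \<le> a"
    unfolding m_def sg_multiplicity_def using pos sub by (auto intro: Least_le)
  have h: "hd ns \<in> \<Gamma>" "0 < hd ns" using pos sub ne hd_in_set by auto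
  have m: "m \<in> \<Gamma>" "0 < m"
    using LeastI[of "\<lambda>x. x \<in> \<Gamma> \<and> 0 < x"] h unfolding m_def sg_multiplicity_def by blast+
  have large: "\<forall>i\<in>{3..length ns}. gen_c ns i * gen_n ns 1 \<le> (gen_c ns i - 1) * gen_n ns i"
  proof
    fix i assume i: "i \<in> {3..length ns}"
    define c where "c = gen_c ns i"
    have "gen_n ns 1 > 0" unfolding gen_n_def using pos ne by simp
    \<comment> \<open>At c = 0 the real quotient is 0 by convention, so the hypothesis would force
      n_1 <= 0.\<close>
    then have c: "c > 0" using assms(2) i unfolding c_def by (cases "gen_c ns i = 0") (auto dest!: bspec[of _ _ i])
    have "real (gen_n ns 1) \<le> (real c - 1) / real c * real (gen_n ns i)"
      using assms(2) i unfolding c_def by blast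
    then have "real c * real (gen_n ns 1) \<le> (real c - 1) * real (gen_n ns i)"
      using c by (simp add: field_simps)
    then have "real (c * gen_n ns 1) \<le> real ((c - 1) * gen_n ns i)" using c by simp
    then show "gen_c ns i * gen_n ns 1 \<le> (gen_c ns i - 1) * gen_n ns i"
      unfolding c_def of_nat_le_iff .
  qed
  have "1 \<le> length ns" using ne by (simp add: Suc_leI)
  from free_apery_bound[OF dist free large m_le this order_refl]
  have R: "apery_regular (int ` \<Gamma>) 1"
    and lower: "\<And>x. x > 0 \<Longrightarrow> int m \<le> int (card (apery (int ` \<Gamma>) x))"
    unfolding d1 take_all[OF order_refl] gen by auto
  have "infinite \<Gamma>"
  proof -
    have closed: "\<forall>s\<in>int ` \<Gamma>. \<forall>t\<in>int ` \<Gamma>. s + t \<in> int ` \<Gamma>"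
      using R unfolding apery_regular_def by blast
    have "int m + int j * int m \<in> int ` \<Gamma>" for j
      using add_multiple_closed[OF closed, of "int m" "int m" j] m(1) by blast
    then have "m + j * m \<in> \<Gamma>" for j
      by (metis (no_types, lifting) imageE of_nat_add of_nat_eq_iff of_nat_mult)
    moreover have "N < m + N * m" for N using m(2) by (cases m) auto
    ultimately show ?thesis unfolding finite_nat_set_iff_bounded by (meson less_asym)
  qed
  then have "\<exists>c. \<forall>x\<ge>c. x \<in> \<Gamma>"
    using R by (intro cofinite_if_finite_apery) (auto simp: apery_regular_def)
  moreover have "m \<le> card (apery (int ` \<Gamma>) (int x))" if "x > 0" for x
    using lower[of "int x"] that by simp
  \<comment> \<open>The bound is attained at x = m, by equality in regularity with d = 1.\<close>
  moreover have "card (apery (int ` \<Gamma>) (int m)) = m"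
    using R m(1) unfolding apery_regular_def by auto
  ultimately show ?thesis
    using feng_rao_number2_eq_min_card_apery m(2) unfolding m_def by blast
qed

end
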